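(* Let $n\ge0$ and let $\boldsymbol E_h^{n+1}\in\mathbb E_h$ be the electric field obtained from the provisional field $\widehat{\boldsymbol E_h^{n+1}}\in\mathbb E_h$ by the divergence-cleaning step $$\boldsymbol E_h^{n+1}=\widehat{\boldsymbol E_h^{n+1}}-\delta\boldsymbol E_h^{n+1},\qquad \delta\boldsymbol E_h^{n+1}=-\nabla_{\boldsymbol x}(\delta\Phi_h^{n+1}),$$ where $\delta\Phi_h^{n+1}\in\mathcal V_{\boldsymbol x}$ solves $$(\nabla_{\boldsymbol x}(\delta\Phi_h^{n+1}),\nabla_{\boldsymbol x}\phi_i)=-(\widehat{\boldsymbol E_h^{n+1}},\nabla_{\boldsymbol x}\phi_i)-(\rho_h^{n+1},\phi_i),\qquad i=1,\dots,N_x.$$ Then, after the divergence cleaning, the electric field satisfies Gauss's law in the weak form: $$(\boldsymbol E_h^{n+1},\nabla_{\boldsymbol x}\phi_i)=-(\rho_h^{n+1},\phi_i),\qquad i=1,\dots,N_x.$$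
   Context: $\Omega_{\boldsymbol x}\subset\mathbb R^{d_x}$ is the configuration space and $\Omega_{\boldsymbol v}$ the velocity space (periodic boundary conditions, or boundary conditions for which boundary terms vanish); $(\cdot,\cdot)$ is the $L^2(\Omega_{\boldsymbol x})$ inner product. $\mathcal T_{\boldsymbol x}$ is a mesh of $\Omega_{\boldsymbol x}$ made of cuboids, each cell $K$ being the image of a reference cuboid $\widehat K$ under an affine map $\boldsymbol T_K$. $\mathcal V_{\boldsymbol x}$ is the space of continuous functions that on each cell are polynomials of degree at most one in each variable, with basis $\{\phi_i\}_{i=1}^{N_x}$. $\mathbb E_h$ is the first-order Nédélec space $$\mathbb E_h=\{\boldsymbol w\in H(\mathrm{curl};\Omega_{\boldsymbol x}):[\nabla_{\widehat{\boldsymbol x}}\boldsymbol T_K]^\top\boldsymbol w\circ\boldsymbol T_K\in[\mathbb Q_{0,1,1}(\widehat K),\mathbb Q_{1,0,1}(\widehat K),\mathbb Q_{1,1,0}(\widehat K)]\ \forall K\in\mathcal T_{\boldsymbol x}\},$$ where $\mathbb Q_{\alpha_1,\alpha_2,\alpha_3}$ denotes polynomials of degree at most $\alpha_i$ in $x_i$; in particular $\nabla_{\boldsymbol x}\mathcal V_{\boldsymbol x}\subset\mathbb E_h$. $\mathbb B_h$ is the first-order Raviart–Thomas space on the same mesh (locally $[\mathbb Q_{1,0,0},\mathbb Q_{0,1,0},\mathbb Q_{0,0,1}]$ on $\widehat K$ through the contravariant Piola map, globally in $H(\mathrm{div};\Omega_{\boldsymbol x})$). Let $f_h^n\in\mathcal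 V_{\boldsymbol x}\otimes\mathcal V_{\boldsymbol v}$ be the discrete distribution function at time $t^n$, where $\mathcal V_{\boldsymbol v}$ is the analogous $\mathbb Q_1$ space on a cuboid mesh of $\Omega_{\boldsymbol v}$. The discrete charge and current densities are $$\rho_h^n=\int_{\Omega_{\boldsymbol v}}f_h^n\,\mathrm d\boldsymbol v-\frac1{|\Omega_{\boldsymbol x}|}\int_{\Omega_{\boldsymbol x}}\int_{\Omega_{\boldsymbol v}}f_h^n\,\mathrm d\boldsymbol v\,\mathrm d\boldsymbol x,\qquad \boldsymbol J_h^n=\int_{\Omega_{\boldsymbol v}}\boldsymbol v f_h^n\,\mathrm d\boldsymbol v.$$ Given $\boldsymbol E_h^n\in\mathbb E_h$ and $\boldsymbol B_h^n\in\mathbb B_h$ and a time step $\tau_n>0$, the provisional field $\widehat{\boldsymbol E_h^{n+1}}\in\mathbb E_h$ is defined by the forward Euler update $$\Big(\frac{\widehat{\boldsymbol E_h^{n+1}}-\boldsymbol E_h^n}{\tau_n},\boldsymbol\eta\Big)=(\boldsymbol B_h^n,\nabla_{\boldsymbol x}\times\boldsymbol\eta)-(\boldsymbol J_h^n,\boldsymbol\eta)\quad\forall\boldsymbol\eta\in\mathbb E_h.$$ *)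

theory Defs
  imports "HOL-Analysis.Analysis" "HOL-Library.Function_Algebras"
begin

type_synonym R3 = "real^3"

subsection \<open>Meshes and boundary conditions\<close>

text \<open>
  A domain with its cuboid mesh, the affine maps from the reference cell, and the boundary
  conditions. The boundary is split into an essential part, a natural part, and a part that is
  identified through translations by the vectors in \<open>periods\<close>. For instance, a fully periodic box
  \<open>box a b\<close> has \<open>periods = {axis i (b$i - a$i) | i. True}\<close> and no other part; without any constraint
  on the boundary, \<open>nat_bdry = frontier Omega\<close>; for a perfect conductor (or a distribution
  function that vanishes at the boundary), \<open>ess_bdry = frontier Omega\<close>.
\<close>

record cuboid_mesh =
  Omega :: "R3 set"
  cells :: "R3 set set"
  refcell :: "R3 set"
  refmap :: "R3 set \<Rightarrow> R3 \<Rightarrow> R3"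
  periods :: "R3 set"
  ess_bdry :: "R3 set"
  nat_bdry :: "R3 set"

text \<open>The relation \<open>division_of\<close> makes the cells finitely many closed boxes with pairwise disjoint
  interiors. Hanging nodes are not excluded.\<close>

definition is_cuboid_mesh :: "cuboid_mesh \<Rightarrow> bool" where
  "is_cuboid_mesh X \<longleftrightarrow>
     cells X division_of \<Union>(cells X) \<and> cells X \<noteq> {} \<and>
     (\<forall>K\<in>cells X. interior K \<noteq> {}) \<and>
     Omega X = interior (\<Union>(cells X)) \<and>
     (\<exists>l u. refcell X = cbox l u) \<and> interior (refcell X) \<noteq> {} \<and>
     (\<forall>K\<in>cells X. (\<exists>(A::real^3^3) b. refmap X K = (\<lambda>x. A *v x + b)) \<and>
        refmap X K ` refcell X = K)"

text \<open>The translates of the domain by the lattice that the periods generate are pairwise disjoint.\<close>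

definition is_boundary_condition :: "cuboid_mesh \<Rightarrow> bool" where
  "is_boundary_condition X \<longleftrightarrow>
     finite (periods X) \<and> 0 \<notin> periods X \<and>
     (\<forall>c::R3 \<Rightarrow> int. let p = (\<Sum>q\<in>periods X. of_int (c q) *\<^sub>R q) in
        p \<noteq> 0 \<longrightarrow> Omega X \<inter> (\<lambda>x. x + p) ` Omega X = {}) \<and>
     ess_bdry X \<inter> nat_bdry X = {} \<and>
     frontier (Omega X) = ess_bdry X \<union> nat_bdry X \<union>
       {x \<in> frontier (Omega X). \<exists>p\<in>periods X. x + p \<in> frontier (Omega X) \<or> x - p \<in> frontier (Omega X)}"

subsection \<open>Differential operators and Sobolev spaces\<close>

definition partial :: "3 \<Rightarrow> (R3 \<Rightarrow> real) \<Rightarrow> R3 \<Rightarrow> real" where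
  "partial i g x = frechet_derivative g (at x) (axis i 1)"

text \<open>The classical pointwise gradient. A continuous piecewise polynomial function is differentiable
  in the interior of every cell, so for it this is the weak gradient, up to the null set formed by
  the cell boundaries.\<close>

definition grad :: "(R3 \<Rightarrow> real) \<Rightarrow> R3 \<Rightarrow> R3" where
  "grad g x = (\<chi> i. partial i g x)"

definition curl :: "(R3 \<Rightarrow> R3) \<Rightarrow> R3 \<Rightarrow> R3" where
  "curl w x = vector
     [partial 2 (\<lambda>y. w y $ 3) x - partial 3 (\<lambda>y. w y $ 2) x,
      partial 3 (\<lambda>y. w y $ 1) x - partial 1 (\<lambda>y. w y $ 3) x,
      partial 1 (\<lambda>y. w y $ 2) x - partial 2 (\<lambda>y. w y $ 1) x]"

definition L2_inner :: "R3 set \<Rightarrow> (R3 \<Rightarrow> 'b::real_inner) \<Rightarrow> (R3 \<Rightarrow> 'b) \<Rightarrow> real" where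
  "L2_inner \<Omega> u w = (LINT x:\<Omega>|lebesgue. u x \<bullet> w x)"

definition L2_space :: "R3 set \<Rightarrow> (R3 \<Rightarrow> 'b::euclidean_space) set" where
  "L2_space \<Omega> = {w. set_borel_measurable lebesgue \<Omega> w \<and>
                    set_integrable lebesgue \<Omega> (\<lambda>x. (norm (w x))\<^sup>2)}"

primrec C_k :: "nat \<Rightarrow> (R3 \<Rightarrow> real) \<Rightarrow> bool" where
  "C_k 0 g \<longleftrightarrow> continuous_on UNIV g"
| "C_k (Suc k) g \<longleftrightarrow>
     (\<exists>G::R3 \<Rightarrow> R3. (\<forall>x. (g has_derivative (\<lambda>h. G x \<bullet> h)) (at x)) \<and> (\<forall>i. C_k k (\<lambda>x. G x $ i)))"

text \<open>Test functions are periodic and vanish near the natural boundary only. The weak derivatives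
  below therefore also encode continuity across periodic faces, and the vanishing of the tangential
  (for the curl) or normal (for the divergence) trace on the essential boundary. If
  \<open>nat_bdry = frontier Omega\<close>, the restrictions of these functions to \<open>Omega\<close> are the smooth functions
  with compact support, and the spaces are the usual \<open>H(curl)\<close> and \<open>H(div)\<close>.\<close>

definition test_fun :: "cuboid_mesh \<Rightarrow> (R3 \<Rightarrow> real) \<Rightarrow> bool" where
  "test_fun X \<psi> \<longleftrightarrow> (\<forall>k. C_k k \<psi>) \<and> (\<forall>p\<in>periods X. \<forall>x. \<psi> (x + p) = \<psi> x) \<and>
     (\<exists>U. open U \<and> nat_bdry X \<subseteq> U \<and> (\<forall>x\<in>U. \<psi> x = 0))"

definition has_weak_curl :: "cuboid_mesh \<Rightarrow> (R3 \<Rightarrow> R3) \<Rightarrow> (R3 \<Rightarrow> R3) \<Rightarrow> bool" where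
  "has_weak_curl X w c \<longleftrightarrow> c \<in> L2_space (Omega X) \<and>
     (\<forall>\<psi>. (\<forall>i. test_fun X (\<lambda>x. \<psi> x $ i)) \<longrightarrow>
        L2_inner (Omega X) w (curl \<psi>) = L2_inner (Omega X) c \<psi>)"

definition has_weak_div :: "cuboid_mesh \<Rightarrow> (R3 \<Rightarrow> R3) \<Rightarrow> (R3 \<Rightarrow> real) \<Rightarrow> bool" where
  "has_weak_div X w d \<longleftrightarrow> d \<in> L2_space (Omega X) \<and>
     (\<forall>\<psi>. test_fun X \<psi> \<longrightarrow> L2_inner (Omega X) w (grad \<psi>) = - L2_inner (Omega X) d \<psi>)"

text \<open>Determined up to null sets.\<close>

definition weak_curl :: "cuboid_mesh \<Rightarrow> (R3 \<Rightarrow> R3) \<Rightarrow> R3 \<Rightarrow> R3" where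
  "weak_curl X w = (SOME c. has_weak_curl X w c)"

definition H_curl :: "cuboid_mesh \<Rightarrow> (R3 \<Rightarrow> R3) set" where
  "H_curl X = {w \<in> L2_space (Omega X). \<exists>c. has_weak_curl X w c}"

definition H_div :: "cuboid_mesh \<Rightarrow> (R3 \<Rightarrow> R3) set" where
  "H_div X = {w \<in> L2_space (Omega X). \<exists>d. has_weak_div X w d}"

subsection \<open>Finite element spaces\<close>

definition Q_poly :: "(3 \<Rightarrow> nat) \<Rightarrow> (R3 \<Rightarrow> real) set" where
  "Q_poly \<alpha> = {p. \<exists>c. p = (\<lambda>x. \<Sum>a | \<forall>i. a i \<le> \<alpha> i. c a * (\<Prod>i\<in>UNIV. (x $ i) ^ a i))}"

text \<open>Functions in \<open>Q1_space\<close> live on the closure of the domain; the value 0 elsewhere makes them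
  determined as elements of the function type, so that bases are meaningful. Elements of
  \<open>nedelec\<close> and \<open>raviart_thomas\<close> are representatives modulo null sets and arbitrary outside the
  domain.\<close>

definition Q1_space :: "cuboid_mesh \<Rightarrow> (R3 \<Rightarrow> real) set" where
  "Q1_space X = {g. continuous_on (closure (Omega X)) g \<and>
     (\<forall>x. x \<notin> closure (Omega X) \<longrightarrow> g x = 0) \<and>
     (\<forall>K\<in>cells X. \<exists>p\<in>Q_poly (\<lambda>_. 1). \<forall>x\<in>K. g x = p x) \<and>
     (\<forall>p\<in>periods X. \<forall>x. x \<in> closure (Omega X) \<and> x + p \<in> closure (Omega X) \<longrightarrow> g (x + p) = g x) \<and>
     (\<forall>x\<in>ess_bdry X. g x = 0)}"

definition nedelec :: "cuboid_mesh \<Rightarrow> (R3 \<Rightarrow> R3) set" where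
  "nedelec X = {w \<in> H_curl X. \<forall>K\<in>cells X.
     \<exists>p. (\<forall>i. (\<lambda>x. p x $ i) \<in> Q_poly (\<lambda>j. if j = i then 0 else 1)) \<and>
       (AE x in lebesgue. x \<in> refcell X \<longrightarrow>
          transpose (jacobian (refmap X K) (at x)) *v w (refmap X K x) = p x)}"

definition raviart_thomas :: "cuboid_mesh \<Rightarrow> (R3 \<Rightarrow> R3) set" where
  "raviart_thomas X = {w \<in> H_div X. \<forall>K\<in>cells X.
     \<exists>p. (\<forall>i. (\<lambda>x. p x $ i) \<in> Q_poly (\<lambda>j. if j = i then 1 else 0)) \<and>
       (AE x in lebesgue. x \<in> refcell X \<longrightarrow>
          w (refmap X K x) = (1 / det (jacobian (refmap X K) (at x))) *\<^sub>R
            (jacobian (refmap X K) (at x) *v p x))}"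

definition tensor_space ::
    "(R3 \<Rightarrow> real) set \<Rightarrow> (R3 \<Rightarrow> real) set \<Rightarrow> (R3 \<Rightarrow> R3 \<Rightarrow> real) set" where
  "tensor_space S T = {f. \<exists>(m::nat) g h. (\<forall>k<m. g k \<in> S \<and> h k \<in> T) \<and>
     f = (\<lambda>x v. \<Sum>k<m. g k x * h k v)}"

definition fun_scale :: "real \<Rightarrow> (R3 \<Rightarrow> real) \<Rightarrow> R3 \<Rightarrow> real" where
  "fun_scale c g = (\<lambda>x. c * g x)"

definition is_basis :: "nat \<Rightarrow> (nat \<Rightarrow> R3 \<Rightarrow> real) \<Rightarrow> (R3 \<Rightarrow> real) set \<Rightarrow> bool" where
  "is_basis N \<phi> S \<longleftrightarrow> inj_on \<phi> {1..N} \<and> \<not> module.dependent fun_scale (\<phi> ` {1..N}) \<and>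
     module.span fun_scale (\<phi> ` {1..N}) = S"

subsection \<open>Charge and current densities\<close>

definition charge_density :: "cuboid_mesh \<Rightarrow> cuboid_mesh \<Rightarrow> (R3 \<Rightarrow> R3 \<Rightarrow> real) \<Rightarrow> R3 \<Rightarrow> real" where
  "charge_density X V f x = (LINT v:Omega V|lebesgue. f x v) -
     1 / measure lebesgue (Omega X) * (LINT y:Omega X|lebesgue. LINT v:Omega V|lebesgue. f y v)"

definition current_density :: "cuboid_mesh \<Rightarrow> (R3 \<Rightarrow> R3 \<Rightarrow> real) \<Rightarrow> R3 \<Rightarrow> R3" where
  "current_density V f x = (LINT v:Omega V|lebesgue. f x v *\<^sub>R v)"

end

theory Submission
  imports Defs
begin

text \<open>
  Almost everywhere in the domain, the corrected field is the provisional field plus the gradient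
  of the potential \<open>\<delta>\<Phi>\<close>, because the two minus signs cancel. Testing with \<open>grad (\<phi> i)\<close>,
  splitting the inner product and inserting the discrete Poisson equation makes the
  contribution of the provisional field cancel, and only the charge term is left.

  The analytic content lies in splitting the inner product: the Lebesgue integral is additive only
  for integrable functions. By the Cauchy--Schwarz inequality it suffices that the provisional field
  and the gradients of \<open>\<delta>\<Phi>\<close> and \<open>\<phi> i\<close> are square integrable. For the provisional field
  this is part of \<open>H_curl\<close>. For the gradients of functions in \<open>Q1_space\<close> it is
  \<open>grad_Q1_space_L2\<close>: on the interior of each cell the gradient is that of a polynomial, hence
  bounded, and the cell boundaries, where the pointwise gradient need not be meaningful, form a
  null set.
\<close>


lemma grad_eqI:
  assumes "(g has_derivative (\<lambda>h. G \<bullet> h)) (at x)"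
  shows "grad g x = G"
proof -
  have "frechet_derivative g (at x) = (\<lambda>h. G \<bullet> h)"
    using frechet_derivative_at[OF assms] by simp
  then show ?thesis
    by (simp add: grad_def partial_def vec_eq_iff inner_axis)
qed

lemma C_1_iff:
  "C_k (Suc 0) g \<longleftrightarrow>
     (\<exists>G. (\<forall>x. (g has_derivative (\<lambda>h. G x \<bullet> h)) (at x)) \<and> continuous_on UNIV G)"
proof -
  have "continuous_on UNIV G \<longleftrightarrow> (\<forall>i. continuous_on UNIV (\<lambda>x. G x $ i))" for G :: "R3 \<Rightarrow> R3"
    using continuous_on_vec_lambda[of UNIV "\<lambda>i x. G x $ i"] continuous_on_component[of UNIV G]
    by (auto simp only: vec_lambda_eta)
  then show ?thesis
    by (simp only: C_k.simps)
qed

text \<open>The \<open>C\<^sup>1\<close> functions contain the constants and coordinates and are closed under sums, products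
  and powers, so they contain all polynomials.\<close>

lemma C_1_const: "C_k (Suc 0) (\<lambda>x. c)"
  unfolding C_1_iff by (intro exI[of _ "\<lambda>x. 0"]) (auto intro!: derivative_eq_intros)

lemma C_1_component: "C_k (Suc 0) (\<lambda>x. x $ i)"
  unfolding C_1_iff
proof (intro exI[of _ "\<lambda>x. axis i 1"] conjI allI)
  show "((\<lambda>x. x $ i) has_derivative (\<lambda>h. axis i 1 \<bullet> h)) (at x)" for x :: R3
    using bounded_linear_imp_has_derivative[OF bounded_linear_vec_nth] by (simp add: inner_axis')
qed (rule continuous_on_const)

lemma C_1_add:
  assumes "C_k (Suc 0) g" "C_k (Suc 0) h"
  shows "C_k (Suc 0) (\<lambda>x. g x + h x)"
proof -
  obtain G where G: "\<And>x. (g has_derivative (\<lambda>d. G x \<bullet> d)) (at x)" "continuous_on UNIV G"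
    using assms(1) unfolding C_1_iff by blast
  obtain H where H: "\<And>x. (h has_derivative (\<lambda>d. H x \<bullet> d)) (at x)" "continuous_on UNIV H"
    using assms(2) unfolding C_1_iff by blast
  show ?thesis
    unfolding C_1_iff
  proof (intro exI[of _ "\<lambda>x. G x + H x"] conjI allI)
    show "((\<lambda>x. g x + h x) has_derivative (\<lambda>d. (G x + H x) \<bullet> d)) (at x)" for x
      using has_derivative_add[OF G(1) H(1)] by (simp add: inner_add_left)
  qed (rule continuous_on_add[OF G(2) H(2)])
qed

lemma C_1_mult:
  assumes "C_k (Suc 0) g" "C_k (Suc 0) h"
  shows "C_k (Suc 0) (\<lambda>x. g x * h x)"
proof -
  obtain G where G: "\<And>x. (g has_derivative (\<lambda>d. G x \<bullet> d)) (at x)" "continuous_on UNIV G"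
    using assms(1) unfolding C_1_iff by blast
  obtain H where H: "\<And>x. (h has_derivative (\<lambda>d. H x \<bullet> d)) (at x)" "continuous_on UNIV H"
    using assms(2) unfolding C_1_iff by blast
  have "continuous_on UNIV g" "continuous_on UNIV h"
    using G(1) H(1) by (meson has_derivative_continuous continuous_at_imp_continuous_on)+
  then have "continuous_on UNIV (\<lambda>x. g x *\<^sub>R H x + h x *\<^sub>R G x)"
    by (intro continuous_on_add continuous_on_scaleR G(2) H(2))
  moreover have "((\<lambda>x. g x * h x) has_derivative (\<lambda>d. (g x *\<^sub>R H x + h x *\<^sub>R G x) \<bullet> d)) (at x)" for x
    using has_derivative_mult[OF G(1) H(1)] by (simp add: inner_add_left mult.commute)
  ultimately show ?thesis
    unfolding C_1_iff by (intro exI[of _ "\<lambda>x. g x *\<^sub>R H x + h x *\<^sub>R G x"] conjI allI)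
qed

lemma C_1_sum: "(\<And>a. a \<in> A \<Longrightarrow> C_k (Suc 0) (g a)) \<Longrightarrow> C_k (Suc 0) (\<lambda>x. \<Sum>a\<in>A. g a x)"
  by (induction A rule: infinite_finite_induct) (simp_all add: C_1_const C_1_add del: C_k.simps)

lemma C_1_prod: "(\<And>a. a \<in> A \<Longrightarrow> C_k (Suc 0) (g a)) \<Longrightarrow> C_k (Suc 0) (\<lambda>x. \<Prod>a\<in>A. g a x)"
  by (induction A rule: infinite_finite_induct) (simp_all add: C_1_const C_1_mult del: C_k.simps)

lemma C_1_power: "C_k (Suc 0) g \<Longrightarrow> C_k (Suc 0) (\<lambda>x. g x ^ m)"
  by (induction m) (simp_all add: C_1_const C_1_mult del: C_k.simps)

lemma Q_poly_C_1: "p \<in> Q_poly \<alpha> \<Longrightarrow> C_k (Suc 0) p"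
  unfolding Q_poly_def
  by (auto intro!: C_1_sum C_1_mult C_1_const C_1_prod C_1_power C_1_component simp del: C_k.simps)

text \<open>The continuous function \<open>F\<close> serves two purposes: the identity gives measurability of the gradient,
  and the squared norm gives square integrability.\<close>

lemma absolutely_integrable_grad_Q1_space:
  fixes F :: "R3 \<Rightarrow> 'b::euclidean_space"
  assumes X: "is_cuboid_mesh X" and g: "g \<in> Q1_space X" and F: "continuous_on UNIV F"
  shows "(\<lambda>x. F (grad g x)) absolutely_integrable_on Omega X"
proof -
  have div: "cells X division_of \<Union>(cells X)" and Om: "Omega X = interior (\<Union>(cells X))"
    using X by (auto simp: is_cuboid_mesh_def)
  have cell: "(\<lambda>x. F (grad g x)) absolutely_integrable_on K" if K: "K \<in> cells X" for K
  proof -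
    have "\<forall>K\<in>cells X. \<exists>p\<in>Q_poly (\<lambda>_. 1). \<forall>x\<in>K. g x = p x"
      using g by (simp add: Q1_space_def)
    then obtain p where p: "p \<in> Q_poly (\<lambda>_. 1)" "\<And>x. x \<in> K \<Longrightarrow> g x = p x"
      using K by auto
    obtain G where G: "\<And>x. (p has_derivative (\<lambda>d. G x \<bullet> d)) (at x)" "continuous_on UNIV G"
      using Q_poly_C_1[OF p(1)] unfolding C_1_iff by auto
    obtain a b where ab: "K = cbox a b"
      using division_ofD(4)[OF div K] by blast
    have grad_G: "grad g x = G x" if "x \<in> interior K" for x
    proof (rule grad_eqI, rule has_derivative_transform_within_open[OF G(1) open_interior that])
      show "p y = g y" if "y \<in> interior K" for y
        using p(2) interior_subset that by (metis subsetD)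
    qed
    have F_G: "(\<lambda>x. F (G x)) absolutely_integrable_on K"
      unfolding ab using continuous_on_compose2[OF F G(2)]
      by (intro absolutely_integrable_continuous) (auto intro: continuous_on_subset)
    have null: "negligible (frontier K)"
      unfolding ab by (intro negligible_convex_frontier convex_box)
    have "K - frontier K \<subseteq> interior K"
      using closure_subset[of K] by (auto simp: frontier_def)
    then show ?thesis
      by (intro absolutely_integrable_spike[OF F_G null]) (metis grad_G subsetD)
  qed
  have "set_integrable lebesgue (\<Union>K\<in>cells X. K) (\<lambda>x. F (grad g x))"
  proof (rule set_integrable_UN)
    show "finite (cells X)" using div by (rule division_of_finite)
    show "K \<in> sets lebesgue" if "K \<in> cells X" for K
      using division_ofD(4)[OF div that] by auto
  qed (rule cell)
  \<comment> \<open>The domain is the interior of the union of the closed cells, hence an open subset of it.\<close>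
  then show ?thesis
    by (rule set_integrable_subset) (auto simp: Om interior_subset)
qed

lemma grad_Q1_space_L2:
  assumes "is_cuboid_mesh X" "g \<in> Q1_space X"
  shows "grad g \<in> L2_space (Omega X)"
proof -
  have "set_integrable lebesgue (Omega X) (\<lambda>x. (norm (grad g x))\<^sup>2)"
    using absolutely_integrable_grad_Q1_space[OF assms, of "\<lambda>y. (norm y)\<^sup>2"]
    by (simp add: continuous_on_power continuous_on_norm continuous_on_id)
  moreover have "set_borel_measurable lebesgue (Omega X) (grad g)"
    using absolutely_integrable_grad_Q1_space[OF assms, of "\<lambda>y. y"]
    by (auto simp: set_integrable_def set_borel_measurable_def)
  ultimately show ?thesis
    by (simp add: L2_space_def)
qed

lemma set_borel_measurable_inner:
  fixes u w :: "R3 \<Rightarrow> 'b::euclidean_space"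
  assumes "set_borel_measurable lebesgue \<Omega> u" "set_borel_measurable lebesgue \<Omega> w"
  shows "set_borel_measurable lebesgue \<Omega> (\<lambda>x. u x \<bullet> w x)"
proof -
  \<comment> \<open>An indicator function is idempotent, so it may multiply both factors.\<close>
  have "(\<lambda>x. (indicator \<Omega> x *\<^sub>R u x) \<bullet> (indicator \<Omega> x *\<^sub>R w x)) \<in> borel_measurable lebesgue"
    using assms unfolding set_borel_measurable_def by (rule borel_measurable_inner)
  also have "(\<lambda>x. (indicator \<Omega> x *\<^sub>R u x) \<bullet> (indicator \<Omega> x *\<^sub>R w x)) =
      (\<lambda>x. indicator \<Omega> x *\<^sub>R (u x \<bullet> w x))"
    by (auto simp: indicator_def)
  finally show ?thesis
    by (simp add: set_borel_measurable_def)
qed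

lemma L2_space_inner_integrable:
  fixes u w :: "R3 \<Rightarrow> 'b::euclidean_space"
  assumes "u \<in> L2_space \<Omega>" "w \<in> L2_space \<Omega>"
  shows "set_integrable lebesgue \<Omega> (\<lambda>x. u x \<bullet> w x)"
proof -
  have "set_integrable lebesgue \<Omega> (\<lambda>x. (norm (u x))\<^sup>2 + (norm (w x))\<^sup>2)"
    using assms by (intro set_integral_add) (auto simp: L2_space_def)
  moreover have "set_borel_measurable lebesgue \<Omega> (\<lambda>x. u x \<bullet> w x)"
    using assms by (intro set_borel_measurable_inner) (auto simp: L2_space_def)
  moreover have "\<bar>u x \<bullet> w x\<bar> \<le> (norm (u x))\<^sup>2 + (norm (w x))\<^sup>2" for x
    using Cauchy_Schwarz_ineq2[of "u x" "w x"] sum_squares_bound[of "norm (u x)" "norm (w x)"]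
      mult_nonneg_nonneg[OF norm_ge_zero[of "u x"] norm_ge_zero[of "w x"]] by linarith
  ultimately show ?thesis
    unfolding set_integrable_def set_borel_measurable_def
    by (elim Bochner_Integration.integrable_bound) (auto simp: indicator_def)
qed

lemma L2_inner_add_left:
  fixes u v w :: "R3 \<Rightarrow> 'b::euclidean_space"
  assumes "u \<in> L2_space \<Omega>" "v \<in> L2_space \<Omega>" "w \<in> L2_space \<Omega>"
  shows "L2_inner \<Omega> (\<lambda>x. u x + v x) w = L2_inner \<Omega> u w + L2_inner \<Omega> v w"
  unfolding L2_inner_def inner_add_left
  using assms by (intro set_integral_add L2_space_inner_integrable)

lemma L2_inner_cong_AE:
  fixes u v w :: "R3 \<Rightarrow> 'b::euclidean_space"
  assumes "AE x in lebesgue. x \<in> \<Omega> \<longrightarrow> u x = v x"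
    and "set_borel_measurable lebesgue \<Omega> u" "set_borel_measurable lebesgue \<Omega> v"
    and "set_borel_measurable lebesgue \<Omega> w"
  shows "L2_inner \<Omega> u w = L2_inner \<Omega> v w"
  unfolding L2_inner_def set_lebesgue_integral_def
proof (rule integral_cong_AE)
  show "AE x in lebesgue. indicator \<Omega> x *\<^sub>R (u x \<bullet> w x) = indicator \<Omega> x *\<^sub>R (v x \<bullet> w x)"
    using assms(1) by eventually_elim (auto simp: indicator_def)
qed (use assms set_borel_measurable_inner in \<open>auto simp: set_borel_measurable_def\<close>)

lemma module_fun_scale: "module fun_scale"
  by unfold_locales (auto simp: fun_scale_def fun_eq_iff algebra_simps)

lemma is_basis_mem: "is_basis N \<phi> S \<Longrightarrow> i \<in> {1..N} \<Longrightarrow> \<phi> i \<in> S"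
  unfolding is_basis_def using module.span_base[OF module_fun_scale] by blast

theorem proposition4p2:
  fixes X V :: cuboid_mesh
    and N\<^sub>x n :: nat
    and \<phi> :: "nat \<Rightarrow> real^3 \<Rightarrow> real"
    and f :: "nat \<Rightarrow> real^3 \<Rightarrow> real^3 \<Rightarrow> real"
    and E E_hat B \<delta>E :: "nat \<Rightarrow> real^3 \<Rightarrow> real^3"
    and \<delta>\<Phi> :: "nat \<Rightarrow> real^3 \<Rightarrow> real"
    and \<tau> :: "nat \<Rightarrow> real"
  assumes "is_cuboid_mesh X" and "is_boundary_condition X"
    and "is_cuboid_mesh V" and "is_boundary_condition V"
    and basis: "is_basis N\<^sub>x \<phi> (Q1_space X)"
    and f: "\<And>k. f k \<in> tensor_space (Q1_space X) (Q1_space V)"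
    and "E n \<in> nedelec X" and "B n \<in> raviart_thomas X" and "\<tau> n > 0"
    and "E_hat (Suc n) \<in> nedelec X"
    and forward_Euler: "\<And>\<eta>. \<eta> \<in> nedelec X \<Longrightarrow>
      L2_inner (Omega X) (\<lambda>x. (1 / \<tau> n) *\<^sub>R (E_hat (Suc n) x - E n x)) \<eta> =
      L2_inner (Omega X) (B n) (weak_curl X \<eta>) - L2_inner (Omega X) (current_density V (f n)) \<eta>"
    and "\<delta>\<Phi> (Suc n) \<in> Q1_space X"
    and Poisson: "\<And>i. i \<in> {1..N\<^sub>x} \<Longrightarrow>
      L2_inner (Omega X) (grad (\<delta>\<Phi> (Suc n))) (grad (\<phi> i)) =
      - L2_inner (Omega X) (E_hat (Suc n)) (grad (\<phi> i))
      - L2_inner (Omega X) (charge_density X V (f (Suc n))) (\<phi> i)"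
    and correction: "AE x in lebesgue. x \<in> Omega X \<longrightarrow> \<delta>E (Suc n) x = - grad (\<delta>\<Phi> (Suc n)) x"
    and "E (Suc n) \<in> nedelec X"
    and cleaning: "AE x in lebesgue. x \<in> Omega X \<longrightarrow> E (Suc n) x = E_hat (Suc n) x - \<delta>E (Suc n) x"
  shows "\<forall>i\<in>{1..N\<^sub>x}. L2_inner (Omega X) (E (Suc n)) (grad (\<phi> i)) =
      - L2_inner (Omega X) (charge_density X V (f (Suc n))) (\<phi> i)"
proof
  fix i assume i: "i \<in> {1..N\<^sub>x}"
  let ?\<Omega> = "Omega X" and ?E = "E (Suc n)" and ?E' = "E_hat (Suc n)"
    and ?g = "grad (\<delta>\<Phi> (Suc n))" and ?w = "grad (\<phi> i)"
  have w: "?w \<in> L2_space ?\<Omega>" and g: "?g \<in> L2_space ?\<Omega>"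
    using \<open>is_cuboid_mesh X\<close> is_basis_mem[OF basis i] \<open>\<delta>\<Phi> (Suc n) \<in> Q1_space X\<close>
    by (auto intro: grad_Q1_space_L2)
  have E: "?E \<in> L2_space ?\<Omega>" and E': "?E' \<in> L2_space ?\<Omega>"
    using \<open>?E \<in> nedelec X\<close> \<open>?E' \<in> nedelec X\<close> by (auto simp: nedelec_def H_curl_def)
  have "AE x in lebesgue. x \<in> ?\<Omega> \<longrightarrow> ?E x = ?E' x + ?g x"
    using cleaning correction by eventually_elim auto
  moreover have "set_borel_measurable lebesgue ?\<Omega> (\<lambda>x. ?E' x + ?g x)"
    using E' g by (auto simp: L2_space_def set_borel_measurable_def scaleR_add_right)
  ultimately have "L2_inner ?\<Omega> ?E ?w = L2_inner ?\<Omega> (\<lambda>x. ?E' x + ?g x) ?w"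
    using E w by (intro L2_inner_cong_AE) (auto simp: L2_space_def)
  also have "\<dots> = L2_inner ?\<Omega> ?E' ?w + L2_inner ?\<Omega> ?g ?w"
    by (rule L2_inner_add_left[OF E' g w])
  also have "\<dots> = - L2_inner ?\<Omega> (charge_density X V (f (Suc n))) (\<phi> i)"
    using Poisson[OF i] by simp
  finally show "L2_inner ?\<Omega> ?E ?w = - L2_inner ?\<Omega> (charge_density X V (f (Suc n))) (\<phi> i)" .
qed

end
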